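(* Let $A=(A_{K,K'})_{K,K'\in\mathcal V}$, $\mathcal V=\{1,\dots,N\}$, be a symmetric positive definite M-matrix of the form $A_{K,K'}=-c_{K,K'}$ for $K\ne K'$ and $A_{K,K}=\sum_{K'\neq K}c_{K,K'}+b_K$, where $c_{K,K'}=c_{K',K}\ge 0$, $b_K\ge 0$ and at least one $b_K$ is strictly positive. Let $\prec$ be a strict partial order on $\mathcal V$ in which any two neighbouring vertices are comparable, let $M$ be the MILU preconditioner of $A$ with respect to $\prec$, and let $\tau_K$ be the localized estimator of condition number (LECN) at $K\in\mathcal V$. Then $$\kappa(M^{-1}A)\le \max_{K\in\mathcal V}\tau_K .$$
   Context: Neighbours: $n_0(K)=\{K'\in\mathcal V: K'\ne K,\ A_{K,K'}\neq 0\}$. Precursors and successors: $p(K)=\{K'\in n_0(K):K'\prec K\}$, $s(K)=\{K'\in n_0(K):K\prec K'\}$, so $n_0(K)=p(K)\sqcup s(K)$. MILU preconditioner: write $A=L+D+L^\top$, where $D$ is the diagonal of $A$ and $L_{K,K'}=A_{K,K'}$ if $K'\in p(K)$ and $L_{K,K'}=0$ otherwise. Define $e_K$ recursively along $\prec$ by $$e_K=A_{K,K}-\sum_{K_1\in p(K)}\ \sum_{K_2\in s(K_1)}\frac{A_{K,K_1}A_{K_1,K_2}}{e_{K_1}},$$ let $E$ be the diagonal matrix with $E_{K,K}=e_K$, and put $M=(L+E)E^{-1}(L+E)^\top$. (Equivalently, $E$ is chosen so that $R=M-A$ has zero row sums.) One has $e_K\ge\sum_{K_1\in s(K)}(-A_{K,K_1})$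 for all $K$. LECN: $\displaystyle \tau_K=\frac{e_K}{e_K+\sum_{K_1\in s(K)}A_{K,K_1}}$, with the convention $\tau_K=+\infty$ when the denominator is $0$ (in which case the bound is vacuous). Condition number: $\kappa(\cdot)=\lambda_{\max}/\lambda_{\min}$, the ratio of the largest to the smallest eigenvalue. *)

theory Defs
  imports "HOL-Analysis.Analysis"
begin

section \<open>Matrix notions\<close>

definition symmetric_matrix :: "real^'n^'n \<Rightarrow> bool" where
  "symmetric_matrix A \<longleftrightarrow> transpose A = A"

definition positive_definite :: "real^'n^'n \<Rightarrow> bool" where
  "positive_definite A \<longleftrightarrow> symmetric_matrix A \<and> (\<forall>x. x \<noteq> 0 \<longrightarrow> x \<bullet> (A *v x) > 0)"

text \<open>Nonsingular M-matrices: nonpositive off-diagonal entries and an entrywise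
  nonnegative inverse.\<close>

definition M_matrix :: "real^'n^'n \<Rightarrow> bool" where
  "M_matrix A \<longleftrightarrow> (\<forall>i j. i \<noteq> j \<longrightarrow> A $ i $ j \<le> 0) \<and> invertible A \<and>
     (\<forall>i j. matrix_inv A $ i $ j \<ge> 0)"

definition diagonal_matrix :: "('n \<Rightarrow> real) \<Rightarrow> real^'n^'n" where
  "diagonal_matrix d = (\<chi> i j. if i = j then d i else 0)"

text \<open>Only real eigenvalues are considered. For the matrices \<open>M\<^sup>-\<^sup>1 A\<close> below with \<open>M\<close> and \<open>A\<close>
  symmetric positive definite this is the whole spectrum, since such a product is similar to a
  symmetric positive definite matrix.\<close>

definition eigenvalues :: "real^'n^'n \<Rightarrow> real set" where
  "eigenvalues B = {l. \<exists>v. v \<noteq> 0 \<and> B *v v = l *\<^sub>R v}"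

definition condition_number :: "real^'n^'n \<Rightarrow> real" where
  "condition_number B = Max (eigenvalues B) / Min (eigenvalues B)"

section \<open>The MILU preconditioner\<close>

definition neighbours :: "real^'n^'n \<Rightarrow> 'n \<Rightarrow> 'n set" where
  "neighbours A K = {K'. K' \<noteq> K \<and> A $ K $ K' \<noteq> 0}"

definition precursors :: "real^'n^'n \<Rightarrow> ('n \<Rightarrow> 'n \<Rightarrow> bool) \<Rightarrow> 'n \<Rightarrow> 'n set" where
  "precursors A prec K = {K' \<in> neighbours A K. prec K' K}"

definition successors :: "real^'n^'n \<Rightarrow> ('n \<Rightarrow> 'n \<Rightarrow> bool) \<Rightarrow> 'n \<Rightarrow> 'n set" where
  "successors A prec K = {K' \<in> neighbours A K. prec K K'}"

definition milu_e :: "real^'n^'n \<Rightarrow> ('n \<Rightarrow> 'n \<Rightarrow> bool) \<Rightarrow> 'n \<Rightarrow> real" where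
  "milu_e A prec = wfrec {(K', K). prec K' K}
     (\<lambda>e K. A $ K $ K -
        (\<Sum>K1 \<in> precursors A prec K. \<Sum>K2 \<in> successors A prec K1.
            A $ K $ K1 * A $ K1 $ K2 / e K1))"

lemma milu_e_rec:
  fixes A :: "real^'n^'n"
  assumes "irreflp prec" and "transp prec"
  shows "milu_e A prec K = A $ K $ K -
    (\<Sum>K1 \<in> precursors A prec K. \<Sum>K2 \<in> successors A prec K1.
        A $ K $ K1 * A $ K1 $ K2 / milu_e A prec K1)"
proof -
  have "wf {(K', K). prec K' K}"
  proof (rule finite_acyclic_wf)
    have "trans {(K', K). prec K' K}"
      using assms(2) by (auto simp: trans_def transp_def)
    then show "acyclic {(K', K). prec K' K}"
      using assms(1) by (auto simp: acyclic_def irreflp_def)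
  qed simp
  then show ?thesis
    unfolding milu_e_def
    by (subst wfrec) (auto simp: cut_def precursors_def intro!: sum.cong)
qed

definition milu_L :: "real^'n^'n \<Rightarrow> ('n \<Rightarrow> 'n \<Rightarrow> bool) \<Rightarrow> real^'n^'n" where
  "milu_L A prec = (\<chi> K K'. if K' \<in> precursors A prec K then A $ K $ K' else 0)"

definition milu_E :: "real^'n^'n \<Rightarrow> ('n \<Rightarrow> 'n \<Rightarrow> bool) \<Rightarrow> real^'n^'n" where
  "milu_E A prec = diagonal_matrix (milu_e A prec)"

definition milu :: "real^'n^'n \<Rightarrow> ('n \<Rightarrow> 'n \<Rightarrow> bool) \<Rightarrow> real^'n^'n" where
  "milu A prec = (let L = milu_L A prec; E = milu_E A prec
     in (L + E) ** matrix_inv E ** transpose (L + E))"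

text \<open>\<open>milu_e A prec K\<close> may vanish when \<open>K\<close> has no successors. Then the denominator below is
  \<open>0\<close>, so the estimator is infinite whenever \<open>milu_E A prec\<close> (hence the preconditioner) fails to
  be invertible.\<close>

definition lecn :: "real^'n^'n \<Rightarrow> ('n \<Rightarrow> 'n \<Rightarrow> bool) \<Rightarrow> 'n \<Rightarrow> ereal" where
  "lecn A prec K =
     (let e = milu_e A prec K; d = e + (\<Sum>K1 \<in> successors A prec K. A $ K $ K1)
      in if d = 0 then \<infinity> else ereal (e / d))"

end

theory Submission
  imports Defs
begin

text \<open>
  Write \<open>M\<close> for the MILU preconditioner, \<open>w K J \<ge> 0\<close> for the weight \<open>c K J\<close> of the edge
  from \<open>K\<close> to a successor \<open>J\<close>, \<open>W K\<close> for the sum of \<open>w K J\<close> over \<open>J\<close>, and \<open>d K = e K - W K\<close>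
  for the denominator of the estimator at \<open>K\<close>. If some \<open>d K\<close> vanishes, the bound is infinite.
  Otherwise all \<open>d K\<close> are positive, by induction along the order (\<open>d_pos\<close>), and the pivots
  \<open>e K\<close> are too.

  The difference of the two quadratic forms is then explicit. Eliminating \<open>K\<close> links every two of
  its successors, and the fill-in that this creates is moved to the diagonal, so \<open>K\<close> contributes
  \<open>V K / e K\<close>, where \<open>V K = (\<Sum>J. w K J) * (\<Sum>J. w K J * (x J)\<^sup>2) - (\<Sum>J. w K J * x J)\<^sup>2\<close> is a weighted
  variance of the values of \<open>x\<close> on the successors of \<open>K\<close> (\<open>form_diff\<close>):
  the form of \<open>A\<close> minus that of \<open>M\<close> equals \<open>\<Sum>K. V K / e K\<close>.

  A variance is nonnegative, so the form of \<open>M\<close> is at most that of \<open>A\<close>. A variance is also at most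
  the second moment about any other point. With the value \<open>x K\<close> as that point,
  \<open>V K / e K \<le> (W K / e K) * (\<Sum>J. w K J * (x K - x J)\<^sup>2)\<close>, and \<open>W K / e K = 1 - 1 / \<tau> K\<close>, where
  \<open>\<tau> K = e K / d K\<close>. Since the edge energies \<open>w K J * (x K - x J)\<^sup>2\<close> add up to at most the form of
  \<open>A\<close>, the difference is at most \<open>(1 - 1 / \<tau>)\<close> times the form of \<open>A\<close> with \<open>\<tau> = Max \<tau> K\<close>; that is,
  the form of \<open>A\<close> is at most \<open>\<tau>\<close> times that of \<open>M\<close> (\<open>form_A_le\<close>).

  So the Rayleigh quotients of \<open>A\<close> relative to \<open>M\<close>, and with them all eigenvalues of the
  preconditioned matrix, lie between \<open>1\<close> and \<open>\<tau>\<close> (\<open>condition_number_le_of_form_bounds\<close>).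
\<close>

section \<open>Generalized eigenvalues of a pair of quadratic forms\<close>

lemma symmetric_matrix_inner:
  assumes "symmetric_matrix S"
  shows "x \<bullet> (S *v y) = y \<bullet> (S *v x)"
  using assms unfolding symmetric_matrix_def
  by (metis dot_lmul_matrix inner_commute transpose_matrix_vector)

lemma matrix_inv_unique:
  fixes B C :: "real^'n^'n"
  assumes "B ** C = mat 1" and "C ** B = mat 1"
  shows "matrix_inv B = C"
proof -
  have inv: "B ** matrix_inv B = mat 1 \<and> matrix_inv B ** B = mat 1"
    unfolding matrix_inv_def by (rule someI[of "\<lambda>X. B ** X = mat 1 \<and> X ** B = mat 1" C]) (simp add: assms)
  have "matrix_inv B = C ** B ** matrix_inv B"
    using assms(2) by simp
  also have "\<dots> = C ** (B ** matrix_inv B)"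
    by (simp only: matrix_mul_assoc)
  also have "\<dots> = C"
    using inv by simp
  finally show ?thesis .
qed

lemma eigenvalues_matrix_inv_mult:
  fixes A M :: "real^'n^'n"
  assumes "invertible M"
  shows "eigenvalues (matrix_inv M ** A) = {l. \<exists>v. v \<noteq> 0 \<and> A *v v = l *\<^sub>R (M *v v)}"
proof -
  have inv: "M ** matrix_inv M = mat 1" "matrix_inv M ** M = mat 1"
    using matrix_inv_unique assms by (auto simp: invertible_def)
  have "(matrix_inv M ** A) *v v = l *\<^sub>R v \<longleftrightarrow> A *v v = l *\<^sub>R (M *v v)" for l v
  proof
    assume eq: "(matrix_inv M ** A) *v v = l *\<^sub>R v"
    have "A *v v = M *v ((matrix_inv M ** A) *v v)"
      by (simp add: matrix_vector_mul_assoc matrix_mul_assoc inv)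
    then show "A *v v = l *\<^sub>R (M *v v)"
      by (simp only: eq matrix_vector_mult_scaleR)
  next
    assume eq: "A *v v = l *\<^sub>R (M *v v)"
    have "(matrix_inv M ** A) *v v = matrix_inv M *v (A *v v)"
      by (simp only: matrix_vector_mul_assoc)
    also have "\<dots> = l *\<^sub>R ((matrix_inv M ** M) *v v)"
      by (simp only: eq matrix_vector_mult_scaleR matrix_vector_mul_assoc)
    finally show "(matrix_inv M ** A) *v v = l *\<^sub>R v"
      by (simp add: inv)
  qed
  then show ?thesis
    by (simp add: eigenvalues_def)
qed

text \<open>At a zero \<open>v\<close> of a nonnegative form the first variation vanishes: if \<open>S v\<close> were nonzero, the
  form would become negative on moving \<open>v\<close> slightly in the direction \<open>- S v\<close>.\<close>

lemma positive_semidefinite_kernel: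
  fixes S :: "real^'n^'n"
  assumes sym: "symmetric_matrix S"
    and nonneg: "\<And>x. 0 \<le> x \<bullet> (S *v x)"
    and zero: "v \<bullet> (S *v v) = 0"
  shows "S *v v = 0"
proof (rule ccontr)
  define w where "w = S *v v"
  define a where "a = w \<bullet> w"
  define q where "q = w \<bullet> (S *v w)"
  \<comment> \<open>The form at \<open>v + t w\<close> is \<open>2 t a + t\<^sup>2 q\<close>, minimal at \<open>- a / q\<close>; the shift to \<open>q + 1\<close> covers
    \<open>q = 0\<close>.\<close>
  define t where "t = - a / (q + 1)"
  assume "S *v v \<noteq> 0"
  then have "a > 0"
    by (simp add: a_def w_def)
  have "q \<ge> 0"
    by (simp add: q_def nonneg)
  have "v \<bullet> (S *v w) = a"
    using symmetric_matrix_inner[OF sym, of v w] by (simp add: a_def w_def)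
  then have "(v + t *\<^sub>R w) \<bullet> (S *v (v + t *\<^sub>R w)) = 2 * t * a + t^2 * q"
    using zero
    by (simp add: matrix_vector_right_distrib matrix_vector_mult_scaleR inner_add_left
        inner_add_right q_def a_def w_def power2_eq_square distrib_left)
  then have "0 \<le> 2 * t * a + t^2 * q"
    using nonneg by metis
  also have "\<dots> = - (a^2 * (q + 2)) / (q + 1)^2"
    using \<open>q \<ge> 0\<close> by (simp add: t_def divide_simps power2_eq_square) algebra
  also have "\<dots> < 0"
    using \<open>a > 0\<close> \<open>q \<ge> 0\<close> by (simp add: divide_neg_pos)
  finally show False by simp
qed

text \<open>The maximizer \<open>v\<close> of the Rayleigh quotient over the unit sphere is an eigenvector: with
  maximal value \<open>r\<close>, the form of \<open>r M - A\<close> is nonnegative and vanishes at \<open>v\<close>, so \<open>v\<close> lies in its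
  kernel. This makes the set of real eigenvalues nonempty, without which its maximum and minimum
  would be unspecified.\<close>

lemma exists_generalized_eigenvalue:
  fixes A M :: "real^'n^'n"
  assumes symA: "symmetric_matrix A" and pdM: "positive_definite M"
  shows "\<exists>l v. v \<noteq> 0 \<and> A *v v = l *\<^sub>R (M *v v)"
proof -
  define r where "r x = (x \<bullet> (A *v x)) / (x \<bullet> (M *v x))" for x
  have M_pos: "x \<bullet> (M *v x) > 0" if "x \<noteq> 0" for x
    using pdM that by (simp add: positive_definite_def)
  have symM: "symmetric_matrix M"
    using pdM by (simp add: positive_definite_def)
  have nz: "x \<bullet> (M *v x) \<noteq> 0" if "x \<in> sphere 0 1" for x
  proof -
    from that have "x \<noteq> 0" by auto
    then show ?thesis
      using M_pos[of x] by simp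
  qed
  have "continuous_on (sphere 0 1) r"
    unfolding r_def using nz
    by (intro continuous_on_divide continuous_on_inner continuous_on_id
        matrix_vector_mul_bounded_linear[THEN linear_continuous_on]) auto
  moreover have "sphere (0::real^'n) 1 \<noteq> {}"
    by simp
  ultimately obtain v where v: "v \<in> sphere 0 1" and v_max: "\<And>y. y \<in> sphere 0 1 \<Longrightarrow> r y \<le> r v"
    using continuous_attains_sup[of "sphere 0 1" r] by auto
  then have "v \<noteq> 0" by auto
  define S where "S = r v *\<^sub>R M - A"
  have S_mult: "S *v x = r v *\<^sub>R (M *v x) - A *v x" for x
    by (simp add: S_def matrix_vector_mult_diff_rdistrib scaleR_matrix_vector_assoc)
  have "symmetric_matrix S"
    using symA symM unfolding symmetric_matrix_def S_def
    by (simp add: transpose_def vec_eq_iff)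
  moreover have "0 \<le> x \<bullet> (S *v x)" for x
  proof (cases "x = 0")
    case False
    have "r x = r (x /\<^sub>R norm x)"
      using False by (simp add: r_def matrix_vector_mult_scaleR)
    also have "\<dots> \<le> r v"
      using False by (intro v_max) simp
    finally show ?thesis
      using M_pos[OF False]
      by (simp add: S_mult inner_diff_right r_def[of x] divide_le_eq)
  qed simp
  moreover have "v \<bullet> (S *v v) = 0"
    using M_pos[OF \<open>v \<noteq> 0\<close>] by (simp add: S_mult inner_diff_right r_def)
  ultimately have "S *v v = 0"
    by (rule positive_semidefinite_kernel)
  then have "A *v v = r v *\<^sub>R (M *v v)"
    by (simp add: S_mult)
  then show ?thesis
    using \<open>v \<noteq> 0\<close> by blast
qed

text \<open>Eigenvectors for different eigenvalues are orthogonal in the inner product of \<open>M\<close>, hence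
  independent, so there are at most as many eigenvalues as dimensions.\<close>

lemma finite_generalized_eigenvalues:
  fixes A M :: "real^'n^'n"
  assumes symA: "symmetric_matrix A" and pdM: "positive_definite M"
  shows "finite {l. \<exists>v. v \<noteq> 0 \<and> A *v v = l *\<^sub>R (M *v v)}"
proof -
  define L where "L = {l. \<exists>v. v \<noteq> 0 \<and> A *v v = l *\<^sub>R (M *v v)}"
  define v where "v l = (SOME v. v \<noteq> 0 \<and> A *v v = l *\<^sub>R (M *v v))" for l
  have symM: "symmetric_matrix M"
    using pdM by (simp add: positive_definite_def)
  have v: "v l \<noteq> 0 \<and> A *v v l = l *\<^sub>R (M *v v l)" if "l \<in> L" for l
    unfolding v_def by (rule someI_ex) (use that L_def in blast)
  have orth: "v k \<bullet> (M *v v l) = 0" if "k \<in> L" "l \<in> L" "k \<noteq> l" for k l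
  proof -
    have "l * (v k \<bullet> (M *v v l)) = v k \<bullet> (A *v v l)"
      using v[OF that(2)] by simp
    also have "\<dots> = v l \<bullet> (A *v v k)"
      by (rule symmetric_matrix_inner[OF symA])
    also have "\<dots> = k * (v l \<bullet> (M *v v k))"
      using v[OF that(1)] by simp
    also have "v l \<bullet> (M *v v k) = v k \<bullet> (M *v v l)"
      by (rule symmetric_matrix_inner[OF symM])
    finally show ?thesis using that(3) by simp
  qed
  have pos: "v l \<bullet> (M *v v l) > 0" if "l \<in> L" for l
    using v[OF that] pdM by (simp add: positive_definite_def)
  have inj: "inj_on v L"
  proof (rule inj_onI, rule ccontr)
    fix k l assume "k \<in> L" "l \<in> L" "v k = v l" "k \<noteq> l"
    then show False
      using orth[of k l] pos[of l] by simp
  qed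
  have "independent (v ` L)"
    unfolding independent_explicit_finite_subsets
  proof (intro allI impI ballI)
    fix T u x
    assume T: "T \<subseteq> v ` L" "finite T" and sum0: "(\<Sum>y\<in>T. u y *\<^sub>R y) = 0" and "x \<in> T"
    obtain l where l: "l \<in> L" "x = v l"
      using T(1) \<open>x \<in> T\<close> by blast
    have zero: "y \<bullet> (M *v x) = 0" if "y \<in> T" "y \<noteq> x" for y
    proof -
      obtain k where "k \<in> L" "y = v k"
        using T(1) \<open>y \<in> T\<close> by blast
      then show ?thesis
        using orth[of k l] l \<open>y \<noteq> x\<close> by blast
    qed
    have "0 = (\<Sum>y\<in>T. u y *\<^sub>R y) \<bullet> (M *v x)"
      by (simp only: sum0 inner_zero_left)
    also have "\<dots> = (\<Sum>y\<in>T. u y * (y \<bullet> (M *v x)))"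
      by (simp add: inner_sum_left)
    also have "\<dots> = (\<Sum>y\<in>T. if y = x then u x * (x \<bullet> (M *v x)) else 0)"
      using zero by (intro sum.cong) auto
    also have "\<dots> = u x * (x \<bullet> (M *v x))"
      using T(2) \<open>x \<in> T\<close> by simp
    finally show "u x = 0"
      using pos[OF l(1)] l(2) by simp
  qed
  then have "finite (v ` L)"
    using independent_bound by blast
  then show ?thesis
    using inj finite_imageD unfolding L_def by blast
qed

text \<open>Pairing \<open>A v = l M v\<close> with \<open>v\<close> shows that \<open>l\<close> is a Rayleigh quotient, which the two bounds
  confine to the interval from \<open>1\<close> to \<open>t\<close>. The upper bound also transfers definiteness from \<open>A\<close>
  to \<open>M\<close>, so that \<open>M\<close> is invertible.\<close>

lemma condition_number_le_of_form_bounds: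
  fixes A M :: "real^'n^'n"
  assumes pdA: "positive_definite A" and symM: "symmetric_matrix M"
    and lower: "\<And>x. x \<bullet> (M *v x) \<le> x \<bullet> (A *v x)"
    and upper: "\<And>x. x \<bullet> (A *v x) \<le> t * (x \<bullet> (M *v x))"
    and t: "0 \<le> t"
  shows "condition_number (matrix_inv M ** A) \<le> t"
proof -
  have symA: "symmetric_matrix A"
    using pdA by (simp add: positive_definite_def)
  have M_pos: "x \<bullet> (M *v x) > 0" if "x \<noteq> 0" for x
  proof -
    have "0 < t * (x \<bullet> (M *v x))"
      using upper[of x] pdA that by (force simp: positive_definite_def)
    then show ?thesis
      using t by (simp add: zero_less_mult_iff)
  qed
  then have pdM: "positive_definite M"
    using symM by (simp add: positive_definite_def)
  have "M *v x = 0 \<Longrightarrow> x = 0" for x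
    using M_pos[of x] by auto
  then have inv: "invertible M"
    by (simp add: invertible_left_inverse matrix_left_invertible_ker)
  let ?L = "eigenvalues (matrix_inv M ** A)"
  have L: "?L = {l. \<exists>v. v \<noteq> 0 \<and> A *v v = l *\<^sub>R (M *v v)}"
    by (rule eigenvalues_matrix_inv_mult[OF inv])
  have fin: "finite ?L"
    unfolding L by (rule finite_generalized_eigenvalues[OF symA pdM])
  have ne: "?L \<noteq> {}"
    unfolding L using exists_generalized_eigenvalue[OF symA pdM] by blast
  have range: "1 \<le> l \<and> l \<le> t" if "l \<in> ?L" for l
  proof -
    obtain v where "v \<noteq> 0" and "A *v v = l *\<^sub>R (M *v v)"
      using \<open>l \<in> ?L\<close> unfolding L by blast
    then have "v \<bullet> (A *v v) = l * (v \<bullet> (M *v v))"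
      by simp
    then show ?thesis
      using lower[of v] upper[of v] M_pos[OF \<open>v \<noteq> 0\<close>] by simp
  qed
  have "1 \<le> Min ?L" "Max ?L \<le> t"
    using fin ne range by auto
  then have "Max ?L / Min ?L \<le> t / 1"
    using t by (intro frac_le) auto
  then show ?thesis
    by (simp add: condition_number_def)
qed

section \<open>Weighted variances\<close>

text \<open>The variance of \<open>x\<close> about its weighted mean, multiplied by the square of the total weight;
  this scaling keeps the formulas polynomial in the weights.\<close>

definition weighted_variance :: "('a::finite \<Rightarrow> real) \<Rightarrow> ('a \<Rightarrow> real) \<Rightarrow> real" where
  "weighted_variance w x = (\<Sum>j\<in>UNIV. w j) * (\<Sum>j\<in>UNIV. w j * (x j)\<^sup>2) - (\<Sum>j\<in>UNIV. w j * x j)\<^sup>2"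

text \<open>The parallel axis theorem: the second moment about \<open>t\<close> exceeds the variance by a square.\<close>

lemma weighted_variance_about:
  "(\<Sum>j\<in>UNIV. w j) * (\<Sum>j\<in>UNIV. w j * (t - x j)\<^sup>2)
     = weighted_variance w x + ((\<Sum>j\<in>UNIV. w j) * t - (\<Sum>j\<in>UNIV. w j * x j))\<^sup>2"
proof -
  have "(\<Sum>j\<in>UNIV. w j * (t - x j)\<^sup>2)
      = (\<Sum>j\<in>UNIV. t\<^sup>2 * w j - 2 * t * (w j * x j) + w j * (x j)\<^sup>2)"
    by (intro sum.cong) (auto simp: power2_eq_square algebra_simps)
  also have "\<dots> = t\<^sup>2 * (\<Sum>j\<in>UNIV. w j) - 2 * t * (\<Sum>j\<in>UNIV. w j * x j)
      + (\<Sum>j\<in>UNIV. w j * (x j)\<^sup>2)"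
    by (simp add: sum.distrib sum_subtractf sum_distrib_left)
  finally have expand: "(\<Sum>j\<in>UNIV. w j * (t - x j)\<^sup>2) = \<dots>" .
  show ?thesis
    unfolding weighted_variance_def expand by (simp add: power2_eq_square algebra_simps)
qed

lemma weighted_variance_le:
  "weighted_variance w x \<le> (\<Sum>j\<in>UNIV. w j) * (\<Sum>j\<in>UNIV. w j * (t - x j)\<^sup>2)"
  by (simp add: weighted_variance_about)

lemma weighted_variance_nonneg:
  assumes "\<And>j. 0 \<le> w j"
  shows "0 \<le> weighted_variance w x"
proof (cases "(\<Sum>j\<in>UNIV. w j) = 0")
  case True
  then have "w j = 0" for j
    using assms by (simp add: sum_nonneg_eq_0_iff)
  then show ?thesis
    by (simp add: weighted_variance_def)
next
  case False
  \<comment> \<open>About the weighted mean the square in the parallel axis theorem vanishes.\<close>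
  let ?t = "(\<Sum>j\<in>UNIV. w j * x j) / (\<Sum>j\<in>UNIV. w j)"
  have "weighted_variance w x = (\<Sum>j\<in>UNIV. w j) * (\<Sum>j\<in>UNIV. w j * (?t - x j)\<^sup>2)"
    using False by (simp add: weighted_variance_about)
  then show ?thesis
    using assms by (simp add: sum_nonneg)
qed

section \<open>The MILU factorization\<close>

text \<open>The quadratic form of \<open>A\<close> is the energy of a graph with edge weights \<open>c\<close> and ground
  weights \<open>b\<close>; the order directs every edge from precursor to successor.\<close>

locale ordered_weighted_graph =
  fixes A :: "real^'n^'n"
    and c :: "'n \<Rightarrow> 'n \<Rightarrow> real"
    and b :: "'n \<Rightarrow> real"
    and prec :: "'n \<Rightarrow> 'n \<Rightarrow> bool"
  assumes off_diag: "\<And>K K'. K \<noteq> K' \<Longrightarrow> A $ K $ K' = - c K K'"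
    and diag: "\<And>K. A $ K $ K = (\<Sum>K' \<in> UNIV - {K}. c K K') + b K"
    and c_sym: "\<And>K K'. K \<noteq> K' \<Longrightarrow> c K K' = c K' K"
    and c_nonneg: "\<And>K K'. K \<noteq> K' \<Longrightarrow> c K K' \<ge> 0"
    and b_nonneg: "\<And>K. b K \<ge> 0"
    and irrefl: "irreflp prec" and trans: "transp prec"
    and comparable: "\<And>K K'. K' \<in> neighbours A K \<Longrightarrow> prec K K' \<or> prec K' K"
begin

text \<open>Weights of the directed edges, extended by zero so that all sums run over \<open>UNIV\<close>.\<close>

definition w :: "'n \<Rightarrow> 'n \<Rightarrow> real" where
  "w K K' = (if K' \<in> successors A prec K then c K K' else 0)"

definition W :: "'n \<Rightarrow> real" where
  "W K = (\<Sum>K'\<in>UNIV. w K K')"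

abbreviation e :: "'n \<Rightarrow> real" where
  "e \<equiv> milu_e A prec"

text \<open>The denominator of the estimator.\<close>

definition d :: "'n \<Rightarrow> real" where
  "d K = e K - W K"

lemma prec_asym: "prec K K' \<Longrightarrow> \<not> prec K' K"
  using irrefl trans by (meson irreflpD transpD)

lemma A_sym: "A $ K $ K' = A $ K' $ K"
  by (cases "K = K'") (auto simp: off_diag c_sym)

lemma precursors_iff_successors: "K' \<in> precursors A prec K \<longleftrightarrow> K \<in> successors A prec K'"
  unfolding precursors_def successors_def neighbours_def using A_sym[of K K'] by auto

lemma w_nonneg: "0 \<le> w K K'"
  by (auto simp: w_def successors_def neighbours_def c_nonneg)

lemma w_eq_neg_A: "w K K' = (if K' \<in> successors A prec K then - (A $ K $ K') else 0)"
  by (auto simp: w_def successors_def neighbours_def off_diag)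

text \<open>Neighbours are comparable, so each edge is counted in exactly one direction.\<close>

lemma off_diag_eq_w:
  assumes "K \<noteq> K'"
  shows "A $ K $ K' = - w K K' - w K' K"
proof (cases "A $ K $ K' = 0")
  case True
  then show ?thesis
    using A_sym[of K K'] by (simp add: w_def successors_def neighbours_def)
next
  case False
  then have "K' \<in> neighbours A K" "K \<in> neighbours A K'"
    using assms A_sym[of K K'] by (auto simp: neighbours_def)
  with comparable[of K' K] prec_asym[of K K'] prec_asym[of K' K] show ?thesis
    using A_sym[of K K'] by (auto simp: w_eq_neg_A successors_def)
qed

lemma w_diag: "w K K = 0"
  by (simp add: w_def successors_def neighbours_def)

lemma W_eq: "W K = - (\<Sum>K'\<in>successors A prec K. A $ K $ K')"
  unfolding W_def w_eq_neg_A by (simp add: sum.If_cases sum_negf)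

lemma W_nonneg: "0 \<le> W K"
  by (simp add: W_def sum_nonneg w_nonneg)

lemma diag_eq_w: "A $ K $ K = W K + (\<Sum>I\<in>UNIV. w I K) + b K"
proof -
  have "(\<Sum>K' \<in> UNIV - {K}. c K K') = (\<Sum>K' \<in> UNIV - {K}. w K K' + w K' K)"
  proof (rule sum.cong)
    fix K' assume "K' \<in> UNIV - {K}"
    then show "c K K' = w K K' + w K' K"
      using off_diag_eq_w[of K K'] off_diag[of K K'] by auto
  qed simp
  also have "\<dots> = (\<Sum>K' \<in> UNIV. w K K' + w K' K)"
    by (intro sum.mono_neutral_left) (auto simp: w_diag)
  finally show ?thesis
    by (simp add: diag sum.distrib W_def)
qed

lemma e_rec: "e K = A $ K $ K - (\<Sum>I\<in>UNIV. w I K * W I / e I)"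
proof -
  have "(\<Sum>K1 \<in> precursors A prec K. \<Sum>K2 \<in> successors A prec K1. A $ K $ K1 * A $ K1 $ K2 / e K1)
      = (\<Sum>I \<in> precursors A prec K. w I K * W I / e I)"
  proof (rule sum.cong)
    fix I assume "I \<in> precursors A prec K"
    then have "A $ K $ I = - w I K"
      using A_sym[of K I] by (simp add: w_eq_neg_A precursors_iff_successors)
    moreover have "(\<Sum>K2 \<in> successors A prec I. A $ K $ I * A $ I $ K2 / e I)
        = A $ K $ I * (\<Sum>K2 \<in> successors A prec I. A $ I $ K2) / e I"
      by (simp only: sum_distrib_left sum_divide_distrib)
    ultimately show "(\<Sum>K2 \<in> successors A prec I. A $ K $ I * A $ I $ K2 / e I) = w I K * W I / e I"
      by (simp add: W_eq)
  qed simp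
  also have "\<dots> = (\<Sum>I\<in>UNIV. w I K * W I / e I)"
    by (intro sum.mono_neutral_left) (auto simp: w_def precursors_iff_successors)
  finally show ?thesis
    using milu_e_rec[OF irrefl trans, of A K] by simp
qed

text \<open>Inserting the diagonal of \<open>A\<close> into the recursion of the pivots gives
  \<open>d K = b K + (\<Sum>I. w I K * (1 - W I / e I))\<close>, and \<open>W I < e I\<close> for every precursor \<open>I\<close>, where
  \<open>d I > 0\<close> is already known. So \<open>d K \<ge> 0\<close>; since it may vanish, strictness comes from the
  hypothesis.\<close>

lemma d_pos:
  assumes nz: "\<And>K. d K \<noteq> 0"
  shows "0 < d K"
proof -
  have "wf {(K', K). prec K' K}"
  proof (rule finite_acyclic_wf)
    show "acyclicP prec"
      using irrefl trans by (simp add: acyclic_irrefl transp_trans irrefl_def irreflp_def)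
  qed simp
  then show ?thesis
  proof (induction K)
    case (less K)
    have "0 \<le> w I K - w I K * W I / e I" for I
    proof (cases "w I K = 0")
      case False
      then have "prec I K"
        by (auto simp: w_def successors_def split: if_splits)
      then have "W I < e I"
        using less by (simp add: d_def)
      then have "W I / e I \<le> 1"
        using W_nonneg[of I] by simp
      then show ?thesis
        using mult_left_mono[OF _ w_nonneg, of "W I / e I" 1 I K] by simp
    qed simp
    then have "0 \<le> (\<Sum>I\<in>UNIV. w I K - w I K * W I / e I)"
      by (simp add: sum_nonneg)
    then have "0 \<le> d K"
      using b_nonneg[of K] by (simp add: d_def e_rec[of K] diag_eq_w sum_subtractf)
    then show ?case
      using nz[of K] by simp
  qed
qed

lemma form_A:
  "x \<bullet> (A *v x) = (\<Sum>K\<in>UNIV. A $ K $ K * (x $ K)\<^sup>2) - 2 * (\<Sum>K\<in>UNIV. x $ K * (\<Sum>J\<in>UNIV. w K J * x $ J))"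
proof -
  have entry: "A $ K $ J = (if J = K then A $ K $ K else 0) - w K J - w J K" for K J
    using off_diag_eq_w[of K J] by (auto simp: w_diag)
  have row: "x $ K * (\<Sum>J\<in>UNIV. A $ K $ J * x $ J) = A $ K $ K * (x $ K)\<^sup>2
      - x $ K * (\<Sum>J\<in>UNIV. w K J * x $ J) - (\<Sum>J\<in>UNIV. w J K * x $ J * x $ K)" for K
  proof -
    have "(\<Sum>J\<in>UNIV. A $ K $ J * x $ J) = (\<Sum>J\<in>UNIV. (if J = K then A $ K $ K * x $ K else 0)
        - w K J * x $ J - w J K * x $ J)"
      by (subst entry, intro sum.cong) (auto simp: algebra_simps)
    also have "\<dots> = A $ K $ K * x $ K - (\<Sum>J\<in>UNIV. w K J * x $ J) - (\<Sum>J\<in>UNIV. w J K * x $ J)"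
      by (simp add: sum_subtractf)
    finally have "(\<Sum>J\<in>UNIV. A $ K $ J * x $ J)
        = A $ K $ K * x $ K - (\<Sum>J\<in>UNIV. w K J * x $ J) - (\<Sum>J\<in>UNIV. w J K * x $ J)" .
    then show ?thesis
      unfolding sum_distrib_right[symmetric]
      by (simp only: right_diff_distrib power2_eq_square mult_ac)
  qed
  have "(\<Sum>K\<in>UNIV. \<Sum>J\<in>UNIV. w J K * x $ J * x $ K) = (\<Sum>J\<in>UNIV. \<Sum>K\<in>UNIV. w J K * x $ J * x $ K)"
    by (rule sum.swap)
  also have "\<dots> = (\<Sum>K\<in>UNIV. x $ K * (\<Sum>J\<in>UNIV. w K J * x $ J))"
    by (simp add: sum_distrib_left mult_ac)
  finally show ?thesis
    by (simp add: inner_vec_def matrix_vector_mult_def row sum_subtractf)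
qed

text \<open>The form of \<open>A\<close> is the energy of the edges plus the nonnegative terms \<open>b K * (x $ K)\<^sup>2\<close>.\<close>

lemma form_A_ge:
  "(\<Sum>K\<in>UNIV. \<Sum>J\<in>UNIV. w K J * (x $ K - x $ J)\<^sup>2) \<le> x \<bullet> (A *v x)"
proof -
  have "(\<Sum>K\<in>UNIV. \<Sum>J\<in>UNIV. w K J * (x $ K - x $ J)\<^sup>2)
     = (\<Sum>K\<in>UNIV. \<Sum>J\<in>UNIV. w K J * (x $ K)\<^sup>2 + w K J * (x $ J)\<^sup>2 - 2 * (x $ K * (w K J * x $ J)))"
    by (intro sum.cong) (auto simp: power2_eq_square algebra_simps)
  also have "\<dots> = (\<Sum>K\<in>UNIV. W K * (x $ K)\<^sup>2) + (\<Sum>K\<in>UNIV. \<Sum>J\<in>UNIV. w K J * (x $ J)\<^sup>2)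
      - 2 * (\<Sum>K\<in>UNIV. x $ K * (\<Sum>J\<in>UNIV. w K J * x $ J))"
    by (simp add: W_def sum.distrib sum_subtractf sum_distrib_left sum_distrib_right)
  also have "(\<Sum>K\<in>UNIV. \<Sum>J\<in>UNIV. w K J * (x $ J)\<^sup>2) = (\<Sum>K\<in>UNIV. (\<Sum>I\<in>UNIV. w I K) * (x $ K)\<^sup>2)"
    by (subst sum.swap) (simp add: sum_distrib_right)
  also have "(\<Sum>K\<in>UNIV. W K * (x $ K)\<^sup>2) + \<dots>
      = (\<Sum>K\<in>UNIV. A $ K $ K * (x $ K)\<^sup>2) - (\<Sum>K\<in>UNIV. b K * (x $ K)\<^sup>2)"
    by (simp add: diag_eq_w sum.distrib distrib_right)
  finally show ?thesis
    using sum_nonneg[of UNIV "\<lambda>K. b K * (x $ K)\<^sup>2"] b_nonneg by (simp add: form_A)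
qed

lemma matrix_inv_milu_E:
  assumes "\<And>K. e K \<noteq> 0"
  shows "matrix_inv (milu_E A prec) = diagonal_matrix (\<lambda>K. 1 / e K)"
proof (rule matrix_inv_unique)
  show "milu_E A prec ** diagonal_matrix (\<lambda>K. 1 / e K) = mat 1"
    and "diagonal_matrix (\<lambda>K. 1 / e K) ** milu_E A prec = mat 1"
    using assms
    by (auto simp: milu_E_def diagonal_matrix_def matrix_matrix_mult_def mat_def vec_eq_iff
        if_distrib[of "\<lambda>z. z * _"] cong: if_cong)
qed

lemma transpose_diagonal_matrix: "transpose (diagonal_matrix f) = diagonal_matrix f"
  by (simp add: diagonal_matrix_def transpose_def vec_eq_iff)

lemma milu_symmetric:
  assumes "\<And>K. e K \<noteq> 0"
  shows "symmetric_matrix (milu A prec)"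
  by (simp add: symmetric_matrix_def milu_def Let_def matrix_inv_milu_E[OF assms]
      matrix_transpose_mul transpose_diagonal_matrix matrix_mul_assoc)

lemma milu_factor_component:
  "(transpose (milu_L A prec + milu_E A prec) *v x) $ K = e K * x $ K - (\<Sum>J\<in>UNIV. w K J * x $ J)"
proof -
  have L: "milu_L A prec $ J $ K = - w K J" for J
    using A_sym[of J K] by (simp add: milu_L_def w_eq_neg_A precursors_iff_successors)
  have "(transpose (milu_L A prec + milu_E A prec) *v x) $ K
      = (\<Sum>J\<in>UNIV. (if J = K then e K * x $ K else 0) - w K J * x $ J)"
    unfolding matrix_vector_mult_def transpose_def
    by (auto simp: L milu_E_def diagonal_matrix_def algebra_simps intro!: sum.cong)
  then show ?thesis
    by (simp add: sum_subtractf)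
qed

lemma form_milu:
  assumes "\<And>K. e K \<noteq> 0"
  shows "x \<bullet> (milu A prec *v x) = (\<Sum>K\<in>UNIV. (e K * x $ K - (\<Sum>J\<in>UNIV. w K J * x $ J))\<^sup>2 / e K)"
proof -
  define y where "y = transpose (milu_L A prec + milu_E A prec) *v x"
  have "x \<bullet> (milu A prec *v x) = y \<bullet> (diagonal_matrix (\<lambda>K. 1 / e K) *v y)"
    unfolding y_def milu_def Let_def matrix_inv_milu_E[OF assms]
    by (simp add: dot_lmul_matrix flip: matrix_vector_mul_assoc)
  also have "\<dots> = (\<Sum>K\<in>UNIV. (y $ K)\<^sup>2 / e K)"
    by (simp add: inner_vec_def matrix_vector_mult_def diagonal_matrix_def power2_eq_square
        if_distrib[of "\<lambda>z. z * _"] cong: if_cong)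
  finally show ?thesis
    by (simp only: y_def milu_factor_component)
qed

text \<open>The two forms have the same mixed terms \<open>x K * x J\<close> of first order in \<open>w\<close>. What remains is the
  loss on the diagonal, \<open>A K K - e K\<close>, which the recursion spreads over the precursors \<open>I\<close> of \<open>K\<close>,
  and the squares of the weighted sums. Collecting the loss by \<open>I\<close> instead of \<open>K\<close> completes each
  square to a variance.\<close>

lemma form_diff:
  assumes nz: "\<And>K. e K \<noteq> 0"
  shows "x \<bullet> (A *v x) - x \<bullet> (milu A prec *v x)
    = (\<Sum>K\<in>UNIV. weighted_variance (w K) (($) x) / e K)"
proof -
  let ?m = "\<lambda>K. \<Sum>J\<in>UNIV. w K J * x $ J"
  have "(\<Sum>K\<in>UNIV. (A $ K $ K - e K) * (x $ K)\<^sup>2)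
      = (\<Sum>K\<in>UNIV. \<Sum>I\<in>UNIV. W I / e I * (w I K * (x $ K)\<^sup>2))"
    by (subst e_rec) (simp add: sum_distrib_left sum_distrib_right mult_ac)
  also have "\<dots> = (\<Sum>I\<in>UNIV. W I * (\<Sum>K\<in>UNIV. w I K * (x $ K)\<^sup>2) / e I)"
    by (subst sum.swap) (simp add: sum_distrib_left sum_divide_distrib)
  finally have fill: "(\<Sum>K\<in>UNIV. (A $ K $ K - e K) * (x $ K)\<^sup>2)
      = (\<Sum>I\<in>UNIV. W I * (\<Sum>K\<in>UNIV. w I K * (x $ K)\<^sup>2) / e I)" .
  have sq: "(e K * x $ K - ?m K)\<^sup>2 / e K = e K * (x $ K)\<^sup>2 - 2 * (x $ K * ?m K) + (?m K)\<^sup>2 / e K" for K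
    using nz[of K] by (simp add: power2_eq_square field_simps)
  have "x \<bullet> (A *v x) - x \<bullet> (milu A prec *v x)
      = (\<Sum>K\<in>UNIV. (A $ K $ K - e K) * (x $ K)\<^sup>2) - (\<Sum>K\<in>UNIV. (?m K)\<^sup>2 / e K)"
    by (simp add: form_A form_milu[OF nz] sq sum.distrib sum_subtractf sum_distrib_left
        left_diff_distrib)
  then show ?thesis
    by (simp add: fill weighted_variance_def W_def diff_divide_distrib sum_subtractf)
qed

lemma form_milu_le:
  assumes "\<And>K. 0 < e K"
  shows "x \<bullet> (milu A prec *v x) \<le> x \<bullet> (A *v x)"
proof -
  have nz: "e K \<noteq> 0" for K
    using assms[of K] by simp
  have "0 \<le> (\<Sum>K\<in>UNIV. weighted_variance (w K) (($) x) / e K)"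
    using assms by (intro sum_nonneg divide_nonneg_pos weighted_variance_nonneg w_nonneg)
  then show ?thesis
    using form_diff[OF nz, of x] by simp
qed

text \<open>For positive \<open>d K\<close>, the bound \<open>e K / d K \<le> t\<close> says that \<open>W K / e K \<le> 1 - 1 / t\<close>. The second
  moment about \<open>x $ K\<close> therefore bounds the term of \<open>K\<close> in the difference of the forms by
  \<open>1 - 1 / t\<close> times the energy of the edges leaving \<open>K\<close>. Summing bounds the difference by
  \<open>1 - 1 / t\<close> times the form of \<open>A\<close>, which rearranges to the claim.\<close>

lemma form_A_le:
  assumes d: "\<And>K. 0 < d K" and t: "\<And>K. e K / d K \<le> t"
  shows "x \<bullet> (A *v x) \<le> t * (x \<bullet> (milu A prec *v x))"
proof -
  have e: "0 < e K" for K
    using d[of K] W_nonneg[of K] by (simp add: d_def)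
  have nz: "e K \<noteq> 0" for K
    using e[of K] by simp
  have "1 \<le> e K / d K" for K
    using d[of K] W_nonneg[of K] by (simp add: d_def)
  then have "1 \<le> t"
    using t order_trans by blast
  have ratio: "W K / e K \<le> 1 - 1 / t" for K
    using t[of K] d[of K] e[of K] \<open>1 \<le> t\<close> by (simp add: d_def field_simps)
  have "x \<bullet> (A *v x) - x \<bullet> (milu A prec *v x)
      = (\<Sum>K\<in>UNIV. weighted_variance (w K) (($) x) / e K)"
    by (rule form_diff[OF nz])
  also have "\<dots> \<le> (\<Sum>K\<in>UNIV. (1 - 1 / t) * (\<Sum>J\<in>UNIV. w K J * (x $ K - x $ J)\<^sup>2))"
  proof (rule sum_mono)
    fix K
    let ?s = "\<Sum>J\<in>UNIV. w K J * (x $ K - x $ J)\<^sup>2"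
    have "weighted_variance (w K) (($) x) / e K \<le> W K * ?s / e K"
      using e[of K] by (intro divide_right_mono) (auto simp: W_def weighted_variance_le)
    also have "\<dots> = (W K / e K) * ?s"
      by simp
    also have "\<dots> \<le> (1 - 1 / t) * ?s"
      by (intro mult_right_mono ratio sum_nonneg) (simp add: w_nonneg)
    finally show "weighted_variance (w K) (($) x) / e K \<le> (1 - 1 / t) * ?s" .
  qed
  also have "\<dots> = (1 - 1 / t) * (\<Sum>K\<in>UNIV. \<Sum>J\<in>UNIV. w K J * (x $ K - x $ J)\<^sup>2)"
    by (simp add: sum_distrib_left)
  also have "\<dots> \<le> (1 - 1 / t) * (x \<bullet> (A *v x))"
    using \<open>1 \<le> t\<close> by (intro mult_left_mono form_A_ge) simp
  finally show ?thesis
    using \<open>1 \<le> t\<close> by (simp add: field_simps)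
qed

lemma lecn_eq: "lecn A prec K = (if d K = 0 then \<infinity> else ereal (e K / d K))"
  by (simp add: lecn_def Let_def d_def W_eq)

end

theorem proposition2p5:
  fixes A :: "real^'n^'n"
    and c :: "'n \<Rightarrow> 'n \<Rightarrow> real"
    and b :: "'n \<Rightarrow> real"
    and prec :: "'n \<Rightarrow> 'n \<Rightarrow> bool"
  assumes "positive_definite A"
    and "M_matrix A"
    and "\<And>K K'. K \<noteq> K' \<Longrightarrow> A $ K $ K' = - c K K'"
    and "\<And>K. A $ K $ K = (\<Sum>K' \<in> UNIV - {K}. c K K') + b K"
    and "\<And>K K'. K \<noteq> K' \<Longrightarrow> c K K' = c K' K"
    and "\<And>K K'. K \<noteq> K' \<Longrightarrow> c K K' \<ge> 0"
    and "\<And>K. b K \<ge> 0"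
    and "\<exists>K. b K > 0"
    and "irreflp prec" and "transp prec"
    and "\<And>K K'. K' \<in> neighbours A K \<Longrightarrow> prec K K' \<or> prec K' K"
  shows "ereal (condition_number (matrix_inv (milu A prec) ** A))
           \<le> (MAX K \<in> UNIV. lecn A prec K)"
proof -
  interpret ordered_weighted_graph A c b prec
    using assms by unfold_locales auto
  have le_max: "lecn A prec K \<le> (MAX K \<in> UNIV. lecn A prec K)" for K
    by (intro Max_ge) auto
  show ?thesis
  proof (cases "\<exists>K. d K = 0")
    case True
    then obtain K where "lecn A prec K = \<infinity>"
      by (auto simp: lecn_eq)
    then show ?thesis
      using le_max[of K] by simp
  next
    case False
    then have d: "0 < d K" for K
      using d_pos by blast
    have e: "0 < e K" for K
      using d[of K] W_nonneg[of K] by (simp add: d_def)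
    have nz: "e K \<noteq> 0" for K
      using e[of K] by simp
    define t where "t = (MAX K \<in> UNIV. e K / d K)"
    have t: "e K / d K \<le> t" for K
      unfolding t_def by (intro Max_ge) auto
    have "t \<in> range (\<lambda>K. e K / d K)"
      unfolding t_def by (intro Max_in) auto
    then obtain K0 where K0: "t = e K0 / d K0"
      by blast
    then have "0 \<le> t"
      using d[of K0] e[of K0] by simp
    have "condition_number (matrix_inv (milu A prec) ** A) \<le> t"
    proof (rule condition_number_le_of_form_bounds)
      show "symmetric_matrix (milu A prec)"
        by (rule milu_symmetric[OF nz])
      show "x \<bullet> (milu A prec *v x) \<le> x \<bullet> (A *v x)" for x
        using e by (rule form_milu_le)
      show "x \<bullet> (A *v x) \<le> t * (x \<bullet> (milu A prec *v x))" for x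
        using d t by (rule form_A_le)
    qed fact+
    then have "ereal (condition_number (matrix_inv (milu A prec) ** A)) \<le> ereal t"
      by simp
    also have "ereal t = lecn A prec K0"
      using d[of K0] by (simp add: lecn_eq K0)
    also have "\<dots> \<le> (MAX K \<in> UNIV. lecn A prec K)"
      by (rule le_max)
    finally show ?thesis .
  qed
qed

end
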